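(* Let $I=\langle\mathcal{A},\emptyset,\mathcal{R},\mathcal{R}^?\rangle$ be an AtIAF and $S\subseteq\mathcal{A}$ a set of arguments. Let $I'=\langle\mathcal{A},\{w\},\mathcal{R},\mathcal{R}^?\cup\{(w,w)\}\rangle$ where $w\notin\mathcal{A}$. Then - $NecVer_{\mathtt{pr}}(I,S)=true$ iff $w\in SRE^+(I'-\{(w,w)\},S,\mathtt{pr}\text{-}false)$; and - $NecVer_{\mathtt{pr}}(I,S)=true$ iff $(w,w)\in SRE^-(I'+\{w\},S,\mathtt{pr}\text{-}false)$.
   Context: An argumentation framework (AF) is a pair $F=\langle \mathcal{A}_F,\mathcal{R}_F\rangle$ with $\mathcal{R}_F\subseteq\mathcal{A}_F\times\mathcal{A}_F$; $a$ attacks $b$ if $(a,b)\in\mathcal{R}_F$. A set $S\subseteq\mathcal{A}_F$ is conflict-free if no element of $S$ attacks an element of $S$; $S$ defends $a$ if every attacker of $a$ is attacked by some element of $S$; $S\in\mathtt{ad}(F)$ (admissible) iff $S$ is conflict-free and defends each of its elements; $S\in\mathtt{pr}(F)$ (preferred) iff $S$ is $\subseteq$-maximal in $\mathtt{ad}(F)$. $S$ is $\mathtt{pr}$-$false$ in $F$ iff $S\notin\mathtt{pr}(F)$. An incomplete argumentation framework (IAF) is $I=\langle\mathcal{A},\mathcal{A}^?,\mathcal{R},\mathcal{R}^?\rangle$ with $\mathcal{A},\mathcal{A}^?$ disjoint sets of (certain, uncertain) arguments and $\mathcal{R},\mathcal{R}^?$ disjoint subsets of $(\mathcal{A}\cup\mathcal{A}^?)\times(\mathcal{A}\cup\mathcal{A}^?)$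 (certain, uncertain attacks). An AtIAF is an IAF with $\mathcal{A}^?=\emptyset$. A partial completion of $I$ is an IAF $I'=\langle\mathcal{A}',\mathcal{A}^{?'},\mathcal{R}',\mathcal{R}^{?'}\rangle$ with $\mathcal{A}\subseteq\mathcal{A}'\subseteq\mathcal{A}\cup\mathcal{A}^?$, $\mathcal{R}\cap((\mathcal{A}'\cup\mathcal{A}^{?'})\times(\mathcal{A}'\cup\mathcal{A}^{?'}))\subseteq\mathcal{R}'\subseteq\mathcal{R}\cup\mathcal{R}^?$, $\mathcal{A}^{?'}\subseteq\mathcal{A}^?$, $\mathcal{R}^{?'}\subseteq\mathcal{R}^?$; $part(I)$ is the set of partial completions. $cert(I)=\langle\mathcal{A},\mathcal{R}\cap(\mathcal{A}\times\mathcal{A})\rangle$. A completion of $I$ is an AF of the form $cert(I')$ with $I'\in part(I)$. $NecVer_{\mathtt{pr}}(I,S)=true$ iff $S\in\mathtt{pr}(F)$ for every completion $F$ of $I$. $S$ is stable-$\mathtt{pr}$-$false$ w.r.t. $I$ iff $S$ is $\mathtt{pr}$-$false$ in every completion of $I$. For $\mathcal{R}_0\subseteq\mathcal{R}^?$: $I+\mathcal{R}_0=\langle\mathcal{A},\mathcal{A}^?,\mathcal{R}\cup\mathcal{R}_0,\mathcal{R}^?\setminus\mathcal{R}_0\rangle$, $I-\mathcal{R}_0=\langle\mathcal{A},\mathcal{A}^?,\mathcal{R},\mathcal{R}^?\setminus\mathcal{R}_0\rangle$. For $\mathcal{A}_0\subseteq\mathcal{A}^?$: $I+\mathcal{A}_0=\langle\mathcal{A}\cup\mathcal{A}_0,\mathcal{A}^?\setminus\mathcal{A}_0,\mathcal{R},\mathcal{R}^?\rangle$,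 and $I-\mathcal{A}_0=\langle\mathcal{A},\mathcal{A}^?\setminus\mathcal{A}_0,\mathcal{R}\setminus\mathcal{R}'',\mathcal{R}^?\setminus\mathcal{R}''\rangle$ where $\mathcal{R}''$ is the set of attacks in $\mathcal{R}\cup\mathcal{R}^?$ having an endpoint in $\mathcal{A}_0$. Strong relevance: for an IAF $J$, a set $S$ of arguments of $J$ such that $S$ is stable-$\mathtt{pr}$-$false$ w.r.t. at least one $J_p\in part(J)$, and an uncertain element (argument or attack) $e$ of $J$: $e\in SRE^+(J,S,\mathtt{pr}\text{-}false)$ (resp. $e\in SRE^-(J,S,\mathtt{pr}\text{-}false)$) iff for each $J'\in part(J-\{e\})$ (resp. $J'\in part(J+\{e\})$), $S$ is not stable-$\mathtt{pr}$-$false$ w.r.t. $J'$. *)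

theory Defs
  imports Main
begin

section \<open>Argumentation frameworks\<close>

text \<open>
  The datatype does not enforce \<open>atts F \<subseteq> args F \<times> args F\<close>; every framework considered below is the
  certain part \<open>cert I\<close> of an incomplete one, which satisfies this by construction.
\<close>

datatype 'a af = AF (args: "'a set") (atts: "('a \<times> 'a) set")

definition conflict_free :: "'a af \<Rightarrow> 'a set \<Rightarrow> bool" where
  "conflict_free F S \<longleftrightarrow> (\<forall>a\<in>S. \<forall>b\<in>S. (a, b) \<notin> atts F)"

definition defends :: "'a af \<Rightarrow> 'a set \<Rightarrow> 'a \<Rightarrow> bool" where
  "defends F S a \<longleftrightarrow> (\<forall>b. (b, a) \<in> atts F \<longrightarrow> (\<exists>c\<in>S. (c, b) \<in> atts F))"

definition ad :: "'a af \<Rightarrow> 'a set set" where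
  "ad F = {S. S \<subseteq> args F \<and> conflict_free F S \<and> (\<forall>a\<in>S. defends F S a)}"

definition pr :: "'a af \<Rightarrow> 'a set set" where
  "pr F = {S \<in> ad F. \<forall>T\<in>ad F. S \<subseteq> T \<longrightarrow> T = S}"

definition pr_false :: "'a af \<Rightarrow> 'a set \<Rightarrow> bool" where
  "pr_false F S \<longleftrightarrow> S \<notin> pr F"

section \<open>Incomplete argumentation frameworks\<close>

datatype 'a iaf =
  IAF (cert_args: "'a set") (unc_args: "'a set")
      (cert_atts: "('a \<times> 'a) set") (unc_atts: "('a \<times> 'a) set")

definition all_args :: "'a iaf \<Rightarrow> 'a set" where
  "all_args I = cert_args I \<union> unc_args I"

definition is_iaf :: "'a iaf \<Rightarrow> bool" where
  "is_iaf I \<longleftrightarrow>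
     cert_args I \<inter> unc_args I = {} \<and>
     cert_atts I \<inter> unc_atts I = {} \<and>
     cert_atts I \<subseteq> all_args I \<times> all_args I \<and>
     unc_atts I \<subseteq> all_args I \<times> all_args I"

definition is_atiaf :: "'a iaf \<Rightarrow> bool" where
  "is_atiaf I \<longleftrightarrow> is_iaf I \<and> unc_args I = {}"

definition part :: "'a iaf \<Rightarrow> 'a iaf set" where
  "part I = {I'. is_iaf I' \<and>
     cert_args I \<subseteq> cert_args I' \<and> cert_args I' \<subseteq> cert_args I \<union> unc_args I \<and>
     cert_atts I \<inter> (all_args I' \<times> all_args I') \<subseteq> cert_atts I' \<and>
     cert_atts I' \<subseteq> cert_atts I \<union> unc_atts I \<and>
     unc_args I' \<subseteq> unc_args I \<and>
     unc_atts I' \<subseteq> unc_atts I}"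

definition cert :: "'a iaf \<Rightarrow> 'a af" where
  "cert I = AF (cert_args I) (cert_atts I \<inter> (cert_args I \<times> cert_args I))"

definition completions :: "'a iaf \<Rightarrow> 'a af set" where
  "completions I = cert ` part I"

definition NecVer_pr :: "'a iaf \<Rightarrow> 'a set \<Rightarrow> bool" where
  "NecVer_pr I S \<longleftrightarrow> (\<forall>F\<in>completions I. S \<in> pr F)"

text \<open>\<open>P\<close> is a verification status of a set in a framework, such as \<^const>\<open>pr_false\<close>.\<close>

definition stable :: "('a af \<Rightarrow> 'a set \<Rightarrow> bool) \<Rightarrow> 'a iaf \<Rightarrow> 'a set \<Rightarrow> bool" where
  "stable P I S \<longleftrightarrow> (\<forall>F\<in>completions I. P F S)"

section \<open>Adding and removing uncertain elements\<close>

definition add_atts :: "'a iaf \<Rightarrow> ('a \<times> 'a) set \<Rightarrow> 'a iaf" where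
  "add_atts I R = IAF (cert_args I) (unc_args I) (cert_atts I \<union> R) (unc_atts I - R)"

definition del_atts :: "'a iaf \<Rightarrow> ('a \<times> 'a) set \<Rightarrow> 'a iaf" where
  "del_atts I R = IAF (cert_args I) (unc_args I) (cert_atts I) (unc_atts I - R)"

definition add_args :: "'a iaf \<Rightarrow> 'a set \<Rightarrow> 'a iaf" where
  "add_args I A = IAF (cert_args I \<union> A) (unc_args I - A) (cert_atts I) (unc_atts I)"

definition del_args :: "'a iaf \<Rightarrow> 'a set \<Rightarrow> 'a iaf" where
  "del_args I A =
     (let R = {(a, b) \<in> cert_atts I \<union> unc_atts I. a \<in> A \<or> b \<in> A}
      in IAF (cert_args I) (unc_args I - A) (cert_atts I - R) (unc_atts I - R))"

datatype 'a element = Arg 'a | Att "'a \<times> 'a"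

definition uncertain :: "'a iaf \<Rightarrow> 'a element set" where
  "uncertain I = Arg ` unc_args I \<union> Att ` unc_atts I"

fun add_elem :: "'a iaf \<Rightarrow> 'a element \<Rightarrow> 'a iaf" where
  "add_elem I (Arg a) = add_args I {a}"
| "add_elem I (Att r) = add_atts I {r}"

fun del_elem :: "'a iaf \<Rightarrow> 'a element \<Rightarrow> 'a iaf" where
  "del_elem I (Arg a) = del_args I {a}"
| "del_elem I (Att r) = del_atts I {r}"

section \<open>Strong relevance\<close>

text \<open>
  Strong relevance is only defined for an IAF \<open>J\<close> and a set \<open>S\<close> of its arguments that has the
  stable status in at least one partial completion. Where this fails, the sets
  \<open>SRE_pos\<close> and \<open>SRE_neg\<close> below are empty, so membership includes this condition.
\<close>

definition SRE_admits :: "'a iaf \<Rightarrow> 'a set \<Rightarrow> ('a af \<Rightarrow> 'a set \<Rightarrow> bool) \<Rightarrow> bool" where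
  "SRE_admits J S P \<longleftrightarrow> is_iaf J \<and> S \<subseteq> all_args J \<and> (\<exists>Jp\<in>part J. stable P Jp S)"

definition SRE_pos :: "'a iaf \<Rightarrow> 'a set \<Rightarrow> ('a af \<Rightarrow> 'a set \<Rightarrow> bool) \<Rightarrow> 'a element set" where
  "SRE_pos J S P =
     {e \<in> uncertain J. SRE_admits J S P \<and> (\<forall>J'\<in>part (del_elem J e). \<not> stable P J' S)}"

definition SRE_neg :: "'a iaf \<Rightarrow> 'a set \<Rightarrow> ('a af \<Rightarrow> 'a set \<Rightarrow> bool) \<Rightarrow> 'a element set" where
  "SRE_neg J S P =
     {e \<in> uncertain J. SRE_admits J S P \<and> (\<forall>J'\<in>part (add_elem J e). \<not> stable P J' S)}"

end

theory Submission
  imports Defs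
begin

text \<open>
  A partial completion can be refined until nothing is uncertain, so quantifying \<open>not stable\<close> over
  all partial completions is the same as necessary verification. Removing \<open>w\<close> from the first IAF gives
  \<open>I\<close> back, and forcing \<open>(w, w)\<close> in the second one adds to \<open>I\<close> an isolated self-attacking argument,
  which belongs to no admissible set. An isolated \<open>w\<close> without self-attack, on the other hand, extends
  every admissible subset of \<open>A\<close>, so \<open>S\<close> is then never preferred.
\<close>

lemma part_trans:
  assumes "K \<in> part J" "L \<in> part K"
  shows "L \<in> part J"
  using assms unfolding part_def all_args_def by (auto; blast)

lemma part_refl: "is_iaf J \<Longrightarrow> J \<in> part J"
  by (auto simp: part_def)

text \<open>Without uncertain arguments the argument set is fixed, so a completion only chooses
  which uncertain attacks to keep. Every choice \<open>X\<close> is realised by a partial completion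
  with nothing left uncertain.\<close>

lemma completions_atiaf:
  assumes "is_atiaf J"
  shows "completions J =
    {AF (cert_args J) X | X. cert_atts J \<subseteq> X \<and> X \<subseteq> cert_atts J \<union> unc_atts J}"
proof (intro equalityI subsetI)
  fix F assume "F \<in> completions J"
  then obtain K where K: "K \<in> part J" "F = cert K"
    by (auto simp: completions_def)
  have "cert_args K = cert_args J" "unc_args K = {}"
    using K(1) assms by (auto simp: part_def is_atiaf_def)
  then show "F \<in> {AF (cert_args J) X | X. cert_atts J \<subseteq> X \<and> X \<subseteq> cert_atts J \<union> unc_atts J}"
    using K assms by (auto simp: part_def is_atiaf_def is_iaf_def all_args_def cert_def)
next
  fix F assume "F \<in> {AF (cert_args J) X | X. cert_atts J \<subseteq> X \<and> X \<subseteq> cert_atts J \<union> unc_atts J}"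
  then obtain X where X: "F = AF (cert_args J) X" "cert_atts J \<subseteq> X" "X \<subseteq> cert_atts J \<union> unc_atts J"
    by auto
  let ?K = "IAF (cert_args J) {} X {}"
  have "cert_atts J \<union> unc_atts J \<subseteq> cert_args J \<times> cert_args J"
    using assms by (auto simp: is_atiaf_def is_iaf_def all_args_def)
  with X(3) have "X \<subseteq> cert_args J \<times> cert_args J"
    by (rule order_trans)
  then have "?K \<in> part J" "F = cert ?K"
    using X by (auto simp: part_def is_iaf_def all_args_def cert_def)
  then show "F \<in> completions J"
    by (auto simp: completions_def)
qed

lemma NecVer_pr_iff_no_stable_pr_false:
  "NecVer_pr J S \<longleftrightarrow> (\<forall>K\<in>part J. \<not> stable pr_false K S)"
proof
  assume nec: "NecVer_pr J S"
  show "\<forall>K\<in>part J. \<not> stable pr_false K S"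
  proof
    fix K assume K: "K \<in> part J"
    then have "cert K \<in> completions K" "cert K \<in> completions J"
      using part_refl by (auto simp: completions_def part_def)
    then show "\<not> stable pr_false K S"
      using nec by (auto simp: NecVer_pr_def stable_def pr_false_def)
  qed
next
  assume nostable: "\<forall>K\<in>part J. \<not> stable pr_false K S"
  show "NecVer_pr J S"
    unfolding NecVer_pr_def
  proof
    fix F assume "F \<in> completions J"
    then obtain K where K: "K \<in> part J" "F = cert K"
      by (auto simp: completions_def)
    \<comment> \<open>\<open>?L\<close> is \<open>F\<close> itself read as an IAF with nothing
      uncertain. Its only completion is \<open>F\<close>, so failing to be stably false there means
      that \<open>S\<close> is preferred in \<open>F\<close>.\<close>
    let ?L = "IAF (args F) {} (atts F) {}"
    have "?L \<in> part K"
      using K by (auto simp: part_def is_iaf_def all_args_def cert_def)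
    then have "\<not> stable pr_false ?L S"
      using nostable part_trans K(1) by blast
    moreover have "is_atiaf ?L"
      using \<open>?L \<in> part K\<close> by (auto simp: part_def is_atiaf_def)
    then have "completions ?L = {F}"
      by (subst completions_atiaf) (cases F, auto)+
    ultimately show "S \<in> pr F"
      by (simp add: stable_def pr_false_def)
  qed
qed

text \<open>Conflict-freeness keeps \<open>w\<close> out of every admissible set, and for sets
  avoiding \<open>w\<close> the attack \<open>(w, w)\<close> affects neither conflicts nor defence.
  The admissible sets therefore coincide, hence so do the maximal ones.\<close>

lemma pr_insert_isolated_self_attacker:
  assumes "X \<subseteq> A \<times> A" "w \<notin> A"
  shows "pr (AF (insert w A) (insert (w, w) X)) = pr (AF A X)"
proof -
  have "ad (AF (insert w A) (insert (w, w) X)) = ad (AF A X)"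
  proof (intro equalityI subsetI)
    fix T assume "T \<in> ad (AF (insert w A) (insert (w, w) X))"
    moreover from this have "w \<notin> T"
      by (auto simp: ad_def conflict_free_def)
    ultimately show "T \<in> ad (AF A X)"
      using assms unfolding ad_def conflict_free_def defends_def by (simp; blast)
  next
    fix T assume "T \<in> ad (AF A X)"
    moreover from this have "w \<notin> T"
      using assms by (auto simp: ad_def)
    ultimately show "T \<in> ad (AF (insert w A) (insert (w, w) X))"
      using assms unfolding ad_def conflict_free_def defends_def by (simp; blast)
  qed
  then show ?thesis by (simp add: pr_def)
qed

text \<open>If \<open>S\<close> were admissible, \<open>insert w S\<close> would be a strictly
  larger admissible set, since \<open>w\<close> creates no conflict and needs no defence.\<close>

lemma not_pr_if_isolated:
  assumes "X \<subseteq> A \<times> A" "w \<notin> A" "S \<subseteq> A"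
  shows "S \<notin> pr (AF (insert w A) X)"
proof
  assume S: "S \<in> pr (AF (insert w A) X)"
  have w: "(a, w) \<notin> X" "(w, a) \<notin> X" for a
    using assms by auto
  have "insert w S \<in> ad (AF (insert w A) X)"
    using S w by (auto simp: pr_def ad_def conflict_free_def defends_def)
  then have "insert w S = S"
    using S by (auto simp: pr_def)
  then show False
    using assms by auto
qed

lemma stable_pr_false_if_isolated:
  assumes "X \<subseteq> A \<times> A" "w \<notin> A" "S \<subseteq> A"
  shows "stable pr_false (IAF (insert w A) {} X {}) S"
proof -
  have "is_atiaf (IAF (insert w A) {} X {})"
    using assms by (auto simp: is_atiaf_def is_iaf_def all_args_def)
  then show ?thesis
    using not_pr_if_isolated[OF assms]
    by (auto simp: completions_atiaf stable_def pr_false_def)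
qed

text \<open>Inserting \<open>(w, w)\<close> into the attacks matches the completions of the two
  IAFs, and matched completions have the same preferred sets.\<close>

lemma NecVer_pr_insert_isolated_self_attacker:
  assumes "is_atiaf (IAF A {} R Ru)" "w \<notin> A"
  shows "NecVer_pr (IAF (insert w A) {} (insert (w, w) R) Ru) S \<longleftrightarrow> NecVer_pr (IAF A {} R Ru) S"
proof -
  have sub: "R \<subseteq> A \<times> A" "Ru \<subseteq> A \<times> A"
    using assms by (auto simp: is_atiaf_def is_iaf_def all_args_def)
  have at: "is_atiaf (IAF (insert w A) {} (insert (w, w) R) Ru)"
    using assms by (auto simp: is_atiaf_def is_iaf_def all_args_def)
  have "completions (IAF (insert w A) {} (insert (w, w) R) Ru) =
      {AF (insert w A) (insert (w, w) X) | X. R \<subseteq> X \<and> X \<subseteq> R \<union> Ru}" (is "?C = ?D")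
  proof (intro equalityI subsetI)
    fix F assume "F \<in> ?C"
    then obtain Y where Y: "F = AF (insert w A) Y"
      "insert (w, w) R \<subseteq> Y" "Y \<subseteq> insert (w, w) R \<union> Ru"
      by (auto simp: completions_atiaf[OF at])
    \<comment> \<open>Neither \<open>R\<close> nor \<open>Ru\<close> contains \<open>(w, w)\<close>,
      because \<open>w\<close> lies outside \<open>A\<close>; removing it from \<open>Y\<close> thus
      recovers the attack set over \<open>A\<close>.\<close>
    have "Y = insert (w, w) (Y - {(w, w)})" "R \<subseteq> Y - {(w, w)}" "Y - {(w, w)} \<subseteq> R \<union> Ru"
      using Y sub assms(2) by auto
    then show "F \<in> ?D"
      using Y(1) by blast
  next
    fix F assume "F \<in> ?D"
    then show "F \<in> ?C"
      by (auto simp: completions_atiaf[OF at])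
  qed
  moreover have "pr (AF (insert w A) (insert (w, w) X)) = pr (AF A X)" if "X \<subseteq> R \<union> Ru" for X
    using that sub assms(2) by (intro pr_insert_isolated_self_attacker) auto
  ultimately show ?thesis
    by (auto simp: NecVer_pr_def completions_atiaf[OF assms(1)]) blast+
qed

theorem proposition7:
  fixes A S :: "'a set" and R Ru :: "('a \<times> 'a) set" and w :: 'a and I I' :: "'a iaf"
  assumes "I = IAF A {} R Ru"
    and "is_atiaf I"
    and "S \<subseteq> A"
    and "w \<notin> A"
    and "I' = IAF A {w} R (Ru \<union> {(w, w)})"
  shows "(NecVer_pr I S \<longleftrightarrow> Arg w \<in> SRE_pos (del_atts I' {(w, w)}) S pr_false) \<and>
         (NecVer_pr I S \<longleftrightarrow> Att (w, w) \<in> SRE_neg (add_args I' {w}) S pr_false)"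
proof -
  have sub: "R \<subseteq> A \<times> A" "Ru \<subseteq> A \<times> A" and disj: "R \<inter> Ru = {}"
    using assms by (auto simp: is_atiaf_def is_iaf_def all_args_def)
  have w: "(a, w) \<notin> R \<union> Ru" "(w, a) \<notin> R \<union> Ru" for a
    using sub assms(4) by auto
  let ?J = "IAF A {w} R Ru" and ?L = "IAF (insert w A) {} R (insert (w, w) Ru)"
  \<comment> \<open>Common witness for both admissibility conditions of strong relevance:
    \<open>w\<close> is present and all uncertain attacks are dropped, so \<open>w\<close> is
    isolated.\<close>
  let ?K = "IAF (insert w A) {} R {}"
  have J: "del_atts I' {(w, w)} = ?J" and L: "add_args I' {w} = ?L"
    using assms(5) w by (auto simp: del_atts_def add_args_def)
  have "?K \<in> part ?J" "?K \<in> part ?L"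
    using sub by (auto simp: part_def is_iaf_def all_args_def)
  moreover have "is_iaf ?J" "is_iaf ?L"
    using sub disj w assms(4) by (auto simp: is_iaf_def all_args_def)
  moreover have "stable pr_false ?K S"
    using sub assms by (intro stable_pr_false_if_isolated)
  ultimately have admits: "SRE_admits ?J S pr_false" "SRE_admits ?L S pr_false"
    using assms(3) by (auto simp: SRE_admits_def all_args_def)
  \<comment> \<open>No attack of \<open>?J\<close> has \<open>w\<close> as an endpoint, so deleting
    \<open>w\<close> removes no attack.\<close>
  have "del_elem ?J (Arg w) = I"
    using assms(1) w by (auto simp: del_args_def Let_def)
  then have pos: "NecVer_pr I S \<longleftrightarrow> Arg w \<in> SRE_pos ?J S pr_false"
    using admits(1) by (simp add: NecVer_pr_iff_no_stable_pr_false SRE_pos_def uncertain_def)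
  have "add_elem ?L (Att (w, w)) = IAF (insert w A) {} (insert (w, w) R) Ru"
    using w by (auto simp: add_atts_def)
  moreover have "NecVer_pr (IAF (insert w A) {} (insert (w, w) R) Ru) S \<longleftrightarrow> NecVer_pr I S"
    using NecVer_pr_insert_isolated_self_attacker assms by metis
  ultimately have neg: "NecVer_pr I S \<longleftrightarrow> Att (w, w) \<in> SRE_neg ?L S pr_false"
    using admits(2) by (simp add: NecVer_pr_iff_no_stable_pr_false SRE_neg_def uncertain_def)
  show ?thesis
    using pos neg by (simp add: J L)
qed

end
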